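(* The category $\mathcal{L}\mathrm{ens}$ has equalisers (of all parallel pairs of lenses).
   Context: All categories that are objects of $\mathcal{L}\mathrm{ens}$ are small. A (delta) lens $(f,\varphi)\colon A \rightleftharpoons B$ between small categories consists of a functor $f\colon A\to B$ together with a lifting operation assigning to each pair ($a\in A$, $u\colon fa\to b$ in $B$) a morphism $\varphi(a,u)\colon a\to a'$ of $A$ with domain $a$, such that (1) $f\varphi(a,u)=u$; (2) $\varphi(a,1_{fa})=1_a$; (3) $\varphi(a,v\circ u)=\varphi(a',v)\circ\varphi(a,u)$, where $a'$ is the codomain of $\varphi(a,u)$. $\mathcal{L}\mathrm{ens}$ is the category with small categories as objects and lenses as morphisms; the composite of $(f,\varphi)\colon A\rightleftharpoons B$ and $(g,\gamma)\colon B\rightleftharpoons C$ is the functor $g\circ f$ with lifting operation $(a,u\colon gfa\to c)\mapsto \varphi(a,\gamma(fa,u))$, and the identity lens on $A$ is the identity functor with lifting operation $(a,u)\mapsto u$. *)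

theory Defs
  imports "HOL-Library.FuncSet"
begin

text \<open>
  Objects and arrows are carrier sets inside arbitrary types. All structure maps are required to
  be \<open>undefined\<close> outside their proper domain, so that equality of records coincides with equality
  of the mathematical structures they encode.
\<close>

record ('o, 'm) cat =
  Obj :: "'o set"
  Arr :: "'m set"
  Dom :: "'m \<Rightarrow> 'o"
  Cod :: "'m \<Rightarrow> 'o"
  Ident :: "'o \<Rightarrow> 'm"
  Comp :: "'m \<Rightarrow> 'm \<Rightarrow> 'm"  \<comment> \<open>\<open>Comp C g f\<close> is \<open>g \<circ> f\<close>\<close>

definition composable :: "('o, 'm) cat \<Rightarrow> 'm \<Rightarrow> 'm \<Rightarrow> bool" where
  "composable C g f \<longleftrightarrow> g \<in> Arr C \<and> f \<in> Arr C \<and> Cod C f = Dom C g"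

locale category =
  fixes C :: "('o, 'm) cat"
  assumes Dom_fun: "Dom C \<in> Arr C \<rightarrow>\<^sub>E Obj C"
    and Cod_fun: "Cod C \<in> Arr C \<rightarrow>\<^sub>E Obj C"
    and Ident_fun: "Ident C \<in> Obj C \<rightarrow>\<^sub>E Arr C"
    and Comp_undefined: "\<not> composable C g f \<Longrightarrow> Comp C g f = undefined"
    and Comp_closed: "composable C g f \<Longrightarrow> Comp C g f \<in> Arr C"
    and Dom_Ident: "x \<in> Obj C \<Longrightarrow> Dom C (Ident C x) = x"
    and Cod_Ident: "x \<in> Obj C \<Longrightarrow> Cod C (Ident C x) = x"
    and Dom_Comp: "composable C g f \<Longrightarrow> Dom C (Comp C g f) = Dom C f"
    and Cod_Comp: "composable C g f \<Longrightarrow> Cod C (Comp C g f) = Cod C g"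
    and Comp_Ident_right: "f \<in> Arr C \<Longrightarrow> Comp C f (Ident C (Dom C f)) = f"
    and Comp_Ident_left: "f \<in> Arr C \<Longrightarrow> Comp C (Ident C (Cod C f)) f = f"
    and Comp_assoc: "composable C h g \<Longrightarrow> composable C g f \<Longrightarrow>
      Comp C (Comp C h g) f = Comp C h (Comp C g f)"

definition is_equaliser :: "('o, 'm) cat \<Rightarrow> 'm \<Rightarrow> 'm \<Rightarrow> 'm \<Rightarrow> bool" where
  "is_equaliser C f g e \<longleftrightarrow>
     e \<in> Arr C \<and> Cod C e = Dom C f \<and> Comp C f e = Comp C g e \<and>
     (\<forall>h \<in> Arr C. Cod C h = Dom C f \<and> Comp C f h = Comp C g h \<longrightarrow>
        (\<exists>!k. k \<in> Arr C \<and> Dom C k = Dom C h \<and> Cod C k = Dom C e \<and> Comp C e k = h))"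

definition has_equalisers :: "('o, 'm) cat \<Rightarrow> bool" where
  "has_equalisers C \<longleftrightarrow>
     (\<forall>f \<in> Arr C. \<forall>g \<in> Arr C. Dom C f = Dom C g \<and> Cod C f = Cod C g \<longrightarrow>
        (\<exists>e. is_equaliser C f g e))"

definition is_functor ::
  "('o, 'm) cat \<Rightarrow> ('o, 'm) cat \<Rightarrow> ('o \<Rightarrow> 'o) \<Rightarrow> ('m \<Rightarrow> 'm) \<Rightarrow> bool" where
  "is_functor A B fo fm \<longleftrightarrow>
     fo \<in> Obj A \<rightarrow>\<^sub>E Obj B \<and> fm \<in> Arr A \<rightarrow>\<^sub>E Arr B \<and>
     (\<forall>u \<in> Arr A. Dom B (fm u) = fo (Dom A u) \<and> Cod B (fm u) = fo (Cod A u)) \<and>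
     (\<forall>a \<in> Obj A. fm (Ident A a) = Ident B (fo a)) \<and>
     (\<forall>v u. composable A v u \<longrightarrow> fm (Comp A v u) = Comp B (fm v) (fm u))"

record ('o, 'm) lens =
  Src :: "('o, 'm) cat"
  Tgt :: "('o, 'm) cat"
  ObjMap :: "'o \<Rightarrow> 'o"
  ArrMap :: "'m \<Rightarrow> 'm"
  Lift :: "'o \<Rightarrow> 'm \<Rightarrow> 'm"

definition liftable :: "('o, 'm) lens \<Rightarrow> 'o \<Rightarrow> 'm \<Rightarrow> bool" where
  "liftable F a u \<longleftrightarrow> a \<in> Obj (Src F) \<and> u \<in> Arr (Tgt F) \<and> Dom (Tgt F) u = ObjMap F a"

locale delta_lens =
  fixes F :: "('o, 'm) lens"
  assumes Src_category: "category (Src F)"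
    and Tgt_category: "category (Tgt F)"
    and functor_part: "is_functor (Src F) (Tgt F) (ObjMap F) (ArrMap F)"
    and Lift_undefined: "\<not> liftable F a u \<Longrightarrow> Lift F a u = undefined"
    and Lift_closed: "liftable F a u \<Longrightarrow> Lift F a u \<in> Arr (Src F)"
    and Dom_Lift: "liftable F a u \<Longrightarrow> Dom (Src F) (Lift F a u) = a"
    and ArrMap_Lift: "liftable F a u \<Longrightarrow> ArrMap F (Lift F a u) = u"
    and Lift_Ident: "a \<in> Obj (Src F) \<Longrightarrow>
      Lift F a (Ident (Tgt F) (ObjMap F a)) = Ident (Src F) a"
    and Lift_Comp: "liftable F a u \<Longrightarrow> composable (Tgt F) v u \<Longrightarrow>
      Lift F a (Comp (Tgt F) v u) =
        Comp (Src F) (Lift F (Cod (Src F) (Lift F a u)) v) (Lift F a u)"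

definition id_lens :: "('o, 'm) cat \<Rightarrow> ('o, 'm) lens" where
  "id_lens A = \<lparr>Src = A, Tgt = A, ObjMap = (\<lambda>a \<in> Obj A. a), ArrMap = (\<lambda>u \<in> Arr A. u),
     Lift = (\<lambda>a u. if a \<in> Obj A \<and> u \<in> Arr A \<and> Dom A u = a then u else undefined)\<rparr>"

definition comp_lens :: "('o, 'm) lens \<Rightarrow> ('o, 'm) lens \<Rightarrow> ('o, 'm) lens" where
  "comp_lens G F = \<lparr>Src = Src F, Tgt = Tgt G,
     ObjMap = compose (Obj (Src F)) (ObjMap G) (ObjMap F),
     ArrMap = compose (Arr (Src F)) (ArrMap G) (ArrMap F),
     Lift = (\<lambda>a u. if a \<in> Obj (Src F) \<and> u \<in> Arr (Tgt G) \<and>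
                       Dom (Tgt G) u = ObjMap G (ObjMap F a)
                   then Lift F a (Lift G (ObjMap F a) u) else undefined)\<rparr>"

text \<open>
  The types \<open>'o\<close> and \<open>'m\<close> play the role of the universe: an object of \<open>Lens\<close> is any category
  whose objects and arrows form sets in these types.
\<close>

definition Lens :: "(('o, 'm) cat, ('o, 'm) lens) cat" where
  "Lens = \<lparr>Obj = {A. category A}, Arr = {F. delta_lens F},
     Dom = (\<lambda>F \<in> {F. delta_lens F}. Src F), Cod = (\<lambda>F \<in> {F. delta_lens F}. Tgt F),
     Ident = (\<lambda>A \<in> {A. category A}. id_lens A),
     Comp = (\<lambda>G F. if delta_lens G \<and> delta_lens F \<and> Tgt F = Src G
                   then comp_lens G F else undefined)\<rparr>"

lemma id_lens_delta_lens:
  assumes "category A"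
  shows "delta_lens (id_lens A)"
proof -
  interpret category A by fact
  note [simp] = Dom_Ident Cod_Ident Comp_closed Dom_Comp Cod_Comp
  have [simp]: "\<And>u. u \<in> Arr A \<Longrightarrow> Dom A u \<in> Obj A" "\<And>u. u \<in> Arr A \<Longrightarrow> Cod A u \<in> Obj A"
    "\<And>x. x \<in> Obj A \<Longrightarrow> Ident A x \<in> Arr A"
    using Dom_fun Cod_fun Ident_fun by auto
  show ?thesis
    using assms
    by unfold_locales
      (auto simp: id_lens_def liftable_def is_functor_def composable_def category_def)
qed

lemma lens_eqI:
  fixes F G :: "('o, 'm) lens"
  assumes "delta_lens F" "delta_lens G" "Src F = Src G" "Tgt F = Tgt G"
    and "\<And>a. a \<in> Obj (Src F) \<Longrightarrow> ObjMap F a = ObjMap G a"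
    and "\<And>u. u \<in> Arr (Src F) \<Longrightarrow> ArrMap F u = ArrMap G u"
    and "\<And>a u. liftable F a u \<Longrightarrow> Lift F a u = Lift G a u"
  shows "F = G"
proof -
  interpret F: delta_lens F by fact
  interpret G: delta_lens G by fact
  have o: "ObjMap F = ObjMap G"
    using F.functor_part G.functor_part assms(3-5) unfolding is_functor_def
    by (metis PiE_ext)
  have m: "ArrMap F = ArrMap G"
    using F.functor_part G.functor_part assms(3,4,6) unfolding is_functor_def
    by (metis PiE_ext)
  have "liftable F a u = liftable G a u" for a u
    using o assms(3,4) by (simp add: liftable_def)
  then have "Lift F = Lift G"
    using F.Lift_undefined G.Lift_undefined assms(7) by (metis ext)
  then show ?thesis using o m assms(3,4) by simp
qed

lemma comp_lens_delta_lens: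
  assumes "delta_lens G" "delta_lens F" and ST: "Tgt F = Src G"
  shows "delta_lens (comp_lens G F)"
proof -
  interpret F: delta_lens F by fact
  interpret G: delta_lens G by fact
  interpret A: category "Src F" by (rule F.Src_category)
  interpret C: category "Tgt G" by (rule G.Tgt_category)
  have FO: "a \<in> Obj (Src F) \<Longrightarrow> ObjMap F a \<in> Obj (Src G)" for a
    using F.functor_part ST by (auto simp: is_functor_def)
  have FA: "u \<in> Arr (Src F) \<Longrightarrow> ArrMap F u \<in> Arr (Src G)" for u
    using F.functor_part ST by (auto simp: is_functor_def)
  have GO: "a \<in> Obj (Src G) \<Longrightarrow> ObjMap G a \<in> Obj (Tgt G)" for a
    using G.functor_part by (auto simp: is_functor_def)
  have GA: "u \<in> Arr (Src G) \<Longrightarrow> ArrMap G u \<in> Arr (Tgt G)" for u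
    using G.functor_part by (auto simp: is_functor_def)
  have FD: "u \<in> Arr (Src F) \<Longrightarrow> Dom (Src G) (ArrMap F u) = ObjMap F (Dom (Src F) u)"
    "u \<in> Arr (Src F) \<Longrightarrow> Cod (Src G) (ArrMap F u) = ObjMap F (Cod (Src F) u)" for u
    using F.functor_part ST by (auto simp: is_functor_def)
  have GD: "u \<in> Arr (Src G) \<Longrightarrow> Dom (Tgt G) (ArrMap G u) = ObjMap G (Dom (Src G) u)"
    "u \<in> Arr (Src G) \<Longrightarrow> Cod (Tgt G) (ArrMap G u) = ObjMap G (Cod (Src G) u)" for u
    using G.functor_part by (auto simp: is_functor_def)
  have FI: "a \<in> Obj (Src F) \<Longrightarrow> ArrMap F (Ident (Src F) a) = Ident (Src G) (ObjMap F a)" for a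
    using F.functor_part ST by (auto simp: is_functor_def)
  have GI: "a \<in> Obj (Src G) \<Longrightarrow> ArrMap G (Ident (Src G) a) = Ident (Tgt G) (ObjMap G a)" for a
    using G.functor_part by (auto simp: is_functor_def)
  have FC: "composable (Src F) v u \<Longrightarrow>
      ArrMap F (Comp (Src F) v u) = Comp (Src G) (ArrMap F v) (ArrMap F u)" for v u
    using F.functor_part ST by (auto simp: is_functor_def)
  have GC: "composable (Src G) v u \<Longrightarrow>
      ArrMap G (Comp (Src G) v u) = Comp (Tgt G) (ArrMap G v) (ArrMap G u)" for v u
    using G.functor_part by (auto simp: is_functor_def)
  have AD: "u \<in> Arr (Src F) \<Longrightarrow> Dom (Src F) u \<in> Obj (Src F)"
    "u \<in> Arr (Src F) \<Longrightarrow> Cod (Src F) u \<in> Obj (Src F)" for u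
    using A.Dom_fun A.Cod_fun by auto
  have AI: "a \<in> Obj (Src F) \<Longrightarrow> Ident (Src F) a \<in> Arr (Src F)" for a
    using A.Ident_fun by auto
  have CI: "a \<in> Obj (Tgt G) \<Longrightarrow> Ident (Tgt G) a \<in> Arr (Tgt G)" for a
    using C.Ident_fun by auto
  let ?L = "comp_lens G F"
  have S [simp]: "Src ?L = Src F" "Tgt ?L = Tgt G" by (simp_all add: comp_lens_def)
  have O: "a \<in> Obj (Src F) \<Longrightarrow> ObjMap ?L a = ObjMap G (ObjMap F a)" for a
    by (simp add: comp_lens_def compose_def)
  have M: "u \<in> Arr (Src F) \<Longrightarrow> ArrMap ?L u = ArrMap G (ArrMap F u)" for u
    by (simp add: comp_lens_def compose_def)
  have compF: "composable (Src G) (ArrMap F v) (ArrMap F u)" if "composable (Src F) v u" for v u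
    using that by (auto simp: composable_def FA FD)
  have lift: "liftable G (ObjMap F a) u \<and> liftable F a (Lift G (ObjMap F a) u) \<and>
      Lift ?L a u = Lift F a (Lift G (ObjMap F a) u)" if "liftable ?L a u" for a u
  proof -
    have *: "a \<in> Obj (Src F)" "u \<in> Arr (Tgt G)" "Dom (Tgt G) u = ObjMap G (ObjMap F a)"
      using that O by (auto simp: liftable_def)
    then have **: "liftable G (ObjMap F a) u" by (simp add: liftable_def FO)
    then have "liftable F a (Lift G (ObjMap F a) u)"
      using * G.Lift_closed[OF **] G.Dom_Lift[OF **] by (simp add: liftable_def ST)
    then show ?thesis using * ** by (simp add: comp_lens_def)
  qed
  show ?thesis
  proof (rule delta_lens.intro)
    show "category (Src ?L)" "category (Tgt ?L)" by (simp_all add: A.category_axioms C.category_axioms)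
    show "is_functor (Src ?L) (Tgt ?L) (ObjMap ?L) (ArrMap ?L)"
      unfolding is_functor_def S
    proof (intro conjI allI impI ballI)
      show "ObjMap ?L \<in> Obj (Src F) \<rightarrow>\<^sub>E Obj (Tgt G)" "ArrMap ?L \<in> Arr (Src F) \<rightarrow>\<^sub>E Arr (Tgt G)"
        by (auto simp: comp_lens_def compose_def FO GO FA GA)
      show "ArrMap ?L (Comp (Src F) v u) = Comp (Tgt G) (ArrMap ?L v) (ArrMap ?L u)"
        if "composable (Src F) v u" for v u
        using that A.Comp_closed[OF that] compF[OF that]
        by (simp add: M FC GC composable_def)
    qed (simp_all add: O M FD GD FA AD FI GI AI FO)
    show "Lift ?L a u = undefined" if "\<not> liftable ?L a u" for a u
      using that O by (auto simp: comp_lens_def liftable_def compose_def)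
    show "Lift ?L a u \<in> Arr (Src ?L)" "Dom (Src ?L) (Lift ?L a u) = a"
      "ArrMap ?L (Lift ?L a u) = u" if "liftable ?L a u" for a u
      using lift[OF that] by (simp_all add: F.Lift_closed F.Dom_Lift F.ArrMap_Lift M G.ArrMap_Lift)
    show "Lift ?L a (Ident (Tgt ?L) (ObjMap ?L a)) = Ident (Src ?L) a" if "a \<in> Obj (Src ?L)" for a
    proof -
      have "liftable ?L a (Ident (Tgt G) (ObjMap G (ObjMap F a)))"
        using that by (simp add: liftable_def O FO GO CI C.Dom_Ident)
      from lift[OF this] show ?thesis
        using that F.Lift_Ident by (simp add: O G.Lift_Ident FO ST)
    qed
    show "Lift ?L a (Comp (Tgt ?L) v u) =
        Comp (Src ?L) (Lift ?L (Cod (Src ?L) (Lift ?L a u)) v) (Lift ?L a u)"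
      if l: "liftable ?L a u" and c: "composable (Tgt ?L) v u" for a u v
    proof -
      let ?b = "ObjMap F a" and ?u = "Lift G (ObjMap F a) u"
      let ?a' = "Cod (Src F) (Lift F a ?u)"
      note lu = lift[OF l]
      have lG: "liftable G ?b u" and lF: "liftable F a ?u" using lu by auto
      have cc: "composable (Tgt G) v u" using c by simp
      have a': "ObjMap F ?a' = Cod (Src G) ?u"
        using FD(2)[OF F.Lift_closed[OF lF]] F.ArrMap_Lift[OF lF] by simp
      have b': "ObjMap G (Cod (Src G) ?u) = Cod (Tgt G) u"
        using GD(2)[OF G.Lift_closed[OF lG]] G.ArrMap_Lift[OF lG] by simp
      have aO: "?a' \<in> Obj (Src F)" by (simp add: AD F.Lift_closed lF)
      have lv: "liftable ?L ?a' v"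
        using cc by (simp add: liftable_def O aO a' b' composable_def)
      note lv' = lift[OF lv]
      have lGv: "liftable G (Cod (Src G) ?u) v" using lv' a' by simp
      have comp: "composable (Tgt F) (Lift G (Cod (Src G) ?u) v) ?u"
        using G.Lift_closed[OF lG] G.Lift_closed[OF lGv] G.Dom_Lift[OF lGv]
        by (simp add: composable_def ST)
      have lc: "liftable ?L a (Comp (Tgt G) v u)"
        using l C.Comp_closed[OF cc] C.Dom_Comp[OF cc] by (simp add: liftable_def)
      have "Lift ?L a (Comp (Tgt G) v u) = Lift F a (Lift G ?b (Comp (Tgt G) v u))"
        using lift[OF lc] by simp
      also have "\<dots> = Lift F a (Comp (Tgt F) (Lift G (Cod (Src G) ?u) v) ?u)"
        using G.Lift_Comp[OF lG cc] by (simp add: ST)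
      also have "\<dots> = Comp (Src F) (Lift F ?a' (Lift G (Cod (Src G) ?u) v)) (Lift F a ?u)"
        using F.Lift_Comp[OF lF comp] .
      finally show ?thesis using lu lv' a' by simp
    qed
  qed
qed

lemma category_Lens: "category (Lens :: (('o, 'm) cat, ('o, 'm) lens) cat)"
proof -
  have fO: "ObjMap F a \<in> Obj (Tgt F)" if "delta_lens F" "a \<in> Obj (Src F)"
    for F :: "('o, 'm) lens" and a
    using delta_lens.functor_part[OF that(1)] that(2) by (auto simp: is_functor_def)
  have fA: "ArrMap F u \<in> Arr (Tgt F)" if "delta_lens F" "u \<in> Arr (Src F)"
    for F :: "('o, 'm) lens" and u
    using delta_lens.functor_part[OF that(1)] that(2) by (auto simp: is_functor_def)
  have sel: "Src (comp_lens G F) = Src F" "Tgt (comp_lens G F) = Tgt G"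
    "Src (id_lens A) = A" "Tgt (id_lens A) = A" for F G :: "('o, 'm) lens" and A
    by (simp_all add: comp_lens_def id_lens_def)
  have cO: "liftable F a u \<Longrightarrow> a \<in> Obj (Src F) \<and> u \<in> Arr (Tgt F) \<and> Dom (Tgt F) u = ObjMap F a"
    for F :: "('o, 'm) lens" and a u
    by (simp add: liftable_def)
  have idr: "comp_lens F (id_lens (Src F)) = F" if F: "delta_lens F" for F :: "('o, 'm) lens"
  proof (rule lens_eqI)
    show "delta_lens (comp_lens F (id_lens (Src F)))"
      using F by (simp add: comp_lens_delta_lens id_lens_delta_lens delta_lens.Src_category sel)
    fix a u assume "liftable (comp_lens F (id_lens (Src F))) a u"
    then have "liftable F a u" by (auto simp: liftable_def comp_lens_def id_lens_def compose_def)
    then show "Lift (comp_lens F (id_lens (Src F))) a u = Lift F a u"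
      using delta_lens.Lift_closed[OF F] delta_lens.Dom_Lift[OF F]
      by (auto simp: liftable_def comp_lens_def id_lens_def)
  qed (use F in \<open>auto simp: comp_lens_def id_lens_def compose_def\<close>)
  have idl: "comp_lens (id_lens (Tgt F)) F = F" if F: "delta_lens F" for F :: "('o, 'm) lens"
  proof (rule lens_eqI)
    show "delta_lens (comp_lens (id_lens (Tgt F)) F)"
      using F by (simp add: comp_lens_delta_lens id_lens_delta_lens delta_lens.Tgt_category sel)
    fix a u assume "liftable (comp_lens (id_lens (Tgt F)) F) a u"
    then have "liftable F a u"
      using fO[OF F] by (auto simp: liftable_def comp_lens_def id_lens_def compose_def)
    then show "Lift (comp_lens (id_lens (Tgt F)) F) a u = Lift F a u"
      using fO[OF F] by (auto simp: liftable_def comp_lens_def id_lens_def)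
  qed (use F fO fA in \<open>auto simp: comp_lens_def id_lens_def compose_def\<close>)
  have assoc: "comp_lens (comp_lens H G) F = comp_lens H (comp_lens G F)"
    if H: "delta_lens H" and G: "delta_lens G" and F: "delta_lens F"
      and GH: "Tgt G = Src H" and FG: "Tgt F = Src G" for F G H :: "('o, 'm) lens"
  proof (rule lens_eqI)
    show "delta_lens (comp_lens (comp_lens H G) F)" "delta_lens (comp_lens H (comp_lens G F))"
      using that by (simp_all add: comp_lens_delta_lens sel)
    fix a u assume "liftable (comp_lens (comp_lens H G) F) a u"
    then have a: "a \<in> Obj (Src F)" and u: "u \<in> Arr (Tgt H)"
      and d: "Dom (Tgt H) u = ObjMap H (ObjMap G (ObjMap F a))"
      using fO[OF F] FG by (auto simp: liftable_def comp_lens_def compose_def)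
    have b: "ObjMap F a \<in> Obj (Src G)" using fO[OF F a] FG by simp
    have c: "ObjMap G (ObjMap F a) \<in> Obj (Src H)" using fO[OF G b] GH by simp
    have l: "liftable H (ObjMap G (ObjMap F a)) u" using u d c by (simp add: liftable_def)
    have "Lift H (ObjMap G (ObjMap F a)) u \<in> Arr (Tgt G)"
      "Dom (Tgt G) (Lift H (ObjMap G (ObjMap F a)) u) = ObjMap G (ObjMap F a)"
      using delta_lens.Lift_closed[OF H l] delta_lens.Dom_Lift[OF H l] GH by simp_all
    then show "Lift (comp_lens (comp_lens H G) F) a u = Lift (comp_lens H (comp_lens G F)) a u"
      using a b u d by (simp add: comp_lens_def compose_def)
  qed (use F fO[OF F] fA[OF F] FG in \<open>auto simp: comp_lens_def compose_def\<close>)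
  show ?thesis
    by unfold_locales
      (auto simp: Lens_def composable_def id_lens_delta_lens comp_lens_delta_lens sel idr idl assoc
        delta_lens.Src_category delta_lens.Tgt_category)
qed

end

theory Submission
  imports Defs
begin

text \<open>
  If \<open>h\<close> is a lens into \<open>A\<close>, then every arrow \<open>u\<close> out of an object \<open>h x\<close> is the image of the lift
  of \<open>u\<close> at \<open>x\<close>, so the image of \<open>h\<close> is a cosieve in \<open>A\<close>. If moreover \<open>f \<circ> h = g \<circ> h\<close>, then
  \<open>f\<close> and \<open>g\<close> agree on all these arrows, and applying \<open>h\<close> to the lifts of the two composites
  shows that the lifting operations of \<open>f\<close> and \<open>g\<close> agree at \<open>h x\<close>. The equaliser is therefore
  the inclusion of the largest cosieve on which \<open>f\<close> and \<open>g\<close> agree as lenses.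
\<close>

section \<open>The subcategory on a cosieve\<close>

definition cosieve :: "('o, 'm) cat \<Rightarrow> 'o set \<Rightarrow> bool" where
  "cosieve A S \<longleftrightarrow> S \<subseteq> Obj A \<and> (\<forall>u \<in> Arr A. Dom A u \<in> S \<longrightarrow> Cod A u \<in> S)"

text \<open>Only the domain of an arrow is tested: for a cosieve the codomain then lies in
  \<open>S\<close> too, so this is the full subcategory on \<open>S\<close>. The guards give
  \<open>undefined\<close> elsewhere, as equality of records requires.\<close>

definition restrict_cat :: "('o, 'm) cat \<Rightarrow> 'o set \<Rightarrow> ('o, 'm) cat" where
  "restrict_cat A S = \<lparr>Obj = S, Arr = {u \<in> Arr A. Dom A u \<in> S},
     Dom = (\<lambda>u \<in> {u \<in> Arr A. Dom A u \<in> S}. Dom A u),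
     Cod = (\<lambda>u \<in> {u \<in> Arr A. Dom A u \<in> S}. Cod A u),
     Ident = (\<lambda>a \<in> S. Ident A a),
     Comp = (\<lambda>v u. if composable A v u \<and> Dom A u \<in> S then Comp A v u else undefined)\<rparr>"

lemma restrict_cat_simps [simp]:
  "Obj (restrict_cat A S) = S"
  "Arr (restrict_cat A S) = {u \<in> Arr A. Dom A u \<in> S}"
  "u \<in> Arr A \<Longrightarrow> Dom A u \<in> S \<Longrightarrow> Dom (restrict_cat A S) u = Dom A u"
  "u \<in> Arr A \<Longrightarrow> Dom A u \<in> S \<Longrightarrow> Cod (restrict_cat A S) u = Cod A u"
  "a \<in> S \<Longrightarrow> Ident (restrict_cat A S) a = Ident A a"
  "composable A v u \<Longrightarrow> Dom A u \<in> S \<Longrightarrow> Comp (restrict_cat A S) v u = Comp A v u"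
  by (simp_all add: restrict_cat_def)

text \<open>\<open>Dom A v = Cod A u\<close> lies in \<open>S\<close> as soon as
  \<open>Dom A u\<close> does, by closure under arrows; hence no condition on \<open>v\<close>
  beyond composability in \<open>A\<close>.\<close>

lemma composable_restrict_cat:
  assumes "cosieve A S"
  shows "composable (restrict_cat A S) v u \<longleftrightarrow> composable A v u \<and> Dom A u \<in> S"
  using assms by (auto simp: composable_def cosieve_def)

lemma category_restrict_cat:
  assumes "category A" and S: "cosieve A S"
  shows "category (restrict_cat A S)"
proof -
  interpret category A by fact
  note [simp] = Dom_Ident Cod_Ident Comp_closed Dom_Comp Cod_Comp Comp_Ident_left
    Comp_Ident_right Comp_assoc composable_restrict_cat[OF S]
  have [simp]: "a \<in> S \<Longrightarrow> a \<in> Obj A" "a \<in> S \<Longrightarrow> Ident A a \<in> Arr A" for a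
    using S Ident_fun by (auto simp: cosieve_def)
  have SC [simp]: "u \<in> Arr A \<Longrightarrow> Dom A u \<in> S \<Longrightarrow> Cod A u \<in> S" for u
    using S by (auto simp: cosieve_def)
  have cA: "v \<in> Arr A \<and> u \<in> Arr A \<and> Cod A u = Dom A v" if "composable A v u" for v u
    using that by (simp add: composable_def)
  have cS: "Dom A v \<in> S" if "composable A v u" "Dom A u \<in> S" for v u
    using SC[of u] cA[OF that(1)] that(2) by simp
  have cI [simp]: "u \<in> Arr A \<Longrightarrow> Dom A u \<in> S \<Longrightarrow> composable A u (Ident A (Dom A u))"
    "u \<in> Arr A \<Longrightarrow> Dom A u \<in> S \<Longrightarrow> composable A (Ident A (Cod A u)) u" for u
    by (simp_all add: composable_def)
  \<comment> \<open>Only these outer instances of \<open>composable\<close> are unfolded; the inner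
    ones stay folded as premises of \<open>Comp_closed\<close>, \<open>Dom_Comp\<close> and
    \<open>Cod_Comp\<close>.\<close>
  have cC: "composable A w (Comp A v u)" "composable A (Comp A w v) u"
    if "composable A w v" "composable A v u" for w v u
    using that cA[OF that(1)] cA[OF that(2)]
    by (simp_all add: composable_def[of A w "Comp A v u"] composable_def[of A "Comp A w v" u])
  show ?thesis
  proof
    show "Dom (restrict_cat A S) \<in> Arr (restrict_cat A S) \<rightarrow>\<^sub>E Obj (restrict_cat A S)"
      "Cod (restrict_cat A S) \<in> Arr (restrict_cat A S) \<rightarrow>\<^sub>E Obj (restrict_cat A S)"
      "Ident (restrict_cat A S) \<in> Obj (restrict_cat A S) \<rightarrow>\<^sub>E Arr (restrict_cat A S)"
      by (auto simp: restrict_cat_def)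
    show "Comp (restrict_cat A S) v u = undefined" if "\<not> composable (restrict_cat A S) v u" for v u
      using that unfolding composable_restrict_cat[OF S] by (auto simp: restrict_cat_def)
    fix w v u assume "composable (restrict_cat A S) w v" "composable (restrict_cat A S) v u"
    then show "Comp (restrict_cat A S) (Comp (restrict_cat A S) w v) u =
        Comp (restrict_cat A S) w (Comp (restrict_cat A S) v u)"
      using cC by simp
  next
    fix v u assume "composable (restrict_cat A S) v u"
    then show "Cod (restrict_cat A S) (Comp (restrict_cat A S) v u) = Cod (restrict_cat A S) v"
      using cA cS by auto
  qed (auto dest: cA cS)
qed

section \<open>Inclusions of cosieves as lenses\<close>

definition inclusion_lens :: "('o, 'm) cat \<Rightarrow> 'o set \<Rightarrow> ('o, 'm) lens" where
  "inclusion_lens A S = \<lparr>Src = restrict_cat A S, Tgt = A, ObjMap = (\<lambda>a \<in> S. a),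
     ArrMap = (\<lambda>u \<in> {u \<in> Arr A. Dom A u \<in> S}. u),
     Lift = (\<lambda>a u. if a \<in> S \<and> u \<in> Arr A \<and> Dom A u = a then u else undefined)\<rparr>"

lemma inclusion_lens_simps [simp]:
  "Src (inclusion_lens A S) = restrict_cat A S"
  "Tgt (inclusion_lens A S) = A"
  "a \<in> S \<Longrightarrow> ObjMap (inclusion_lens A S) a = a"
  "u \<in> Arr A \<Longrightarrow> Dom A u \<in> S \<Longrightarrow> ArrMap (inclusion_lens A S) u = u"
  "u \<in> Arr A \<Longrightarrow> Dom A u \<in> S \<Longrightarrow> Lift (inclusion_lens A S) (Dom A u) u = u"
  by (simp_all add: inclusion_lens_def)

lemma liftable_inclusion_lens:
  "liftable (inclusion_lens A S) a u \<longleftrightarrow> a \<in> S \<and> u \<in> Arr A \<and> Dom A u = a"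
  by (auto simp: liftable_def)

text \<open>An arrow of \<open>A\<close> leaving an object of \<open>S\<close> already belongs to
  the subcategory, so it can serve as its own lift, and the lens laws become trivial
  identities.\<close>

lemma inclusion_lens_delta_lens:
  assumes "category A" and S: "cosieve A S"
  shows "delta_lens (inclusion_lens A S)"
proof -
  interpret category A by fact
  note [simp] = Dom_Ident Cod_Ident Comp_closed Dom_Comp Cod_Comp
    composable_restrict_cat[OF S] liftable_inclusion_lens
  have [simp]: "a \<in> S \<Longrightarrow> a \<in> Obj A" "a \<in> S \<Longrightarrow> Ident A a \<in> Arr A" for a
    using S Ident_fun by (auto simp: cosieve_def)
  have SC [simp]: "u \<in> Arr A \<Longrightarrow> Dom A u \<in> S \<Longrightarrow> Cod A u \<in> S" for u
    using S by (auto simp: cosieve_def)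
  have cA: "v \<in> Arr A \<and> u \<in> Arr A \<and> Cod A u = Dom A v" if "composable A v u" for v u
    using that by (simp add: composable_def)
  have cS: "Dom A v \<in> S" if "composable A v u" "Dom A u \<in> S" for v u
    using SC[of u] cA[OF that(1)] that(2) by simp
  \<comment> \<open>The simplification rule expects the object in the form \<open>Dom A u\<close>;
    here it may be any term equal to that.\<close>
  have LI: "Lift (inclusion_lens A S) a u = u" if "a \<in> S" "u \<in> Arr A" "Dom A u = a" for a u
    using that by auto
  show ?thesis
  proof (rule delta_lens.intro)
    show "category (Src (inclusion_lens A S))" "category (Tgt (inclusion_lens A S))"
      using category_restrict_cat[OF assms] assms(1) by simp_all
    have "ObjMap (inclusion_lens A S) \<in> S \<rightarrow>\<^sub>E Obj A"
      "ArrMap (inclusion_lens A S) \<in> {u \<in> Arr A. Dom A u \<in> S} \<rightarrow>\<^sub>E Arr A"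
      by (auto simp: inclusion_lens_def)
    then show "is_functor (Src (inclusion_lens A S)) (Tgt (inclusion_lens A S))
        (ObjMap (inclusion_lens A S)) (ArrMap (inclusion_lens A S))"
      using cA cS by (auto simp: is_functor_def)
    show "Lift (inclusion_lens A S) a u = undefined"
      if "\<not> liftable (inclusion_lens A S) a u" for a u
      using that unfolding liftable_inclusion_lens by (auto simp: inclusion_lens_def)
    fix a u v
    assume "liftable (inclusion_lens A S) a u" "composable (Tgt (inclusion_lens A S)) v u"
    then show "Lift (inclusion_lens A S) a (Comp (Tgt (inclusion_lens A S)) v u) =
        Comp (Src (inclusion_lens A S))
          (Lift (inclusion_lens A S) (Cod (Src (inclusion_lens A S)) (Lift (inclusion_lens A S) a u)) v)
          (Lift (inclusion_lens A S) a u)"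
      using cA cS by (auto simp: LI)
  qed (auto simp: LI)
qed

section \<open>Factorising a lens through a cosieve inclusion\<close>

lemma Tgt_update_delta_lens:
  assumes "delta_lens H" and S: "cosieve (Tgt H) S" and im: "ObjMap H ` Obj (Src H) \<subseteq> S"
  shows "delta_lens (H\<lparr>Tgt := restrict_cat (Tgt H) S\<rparr>)"
proof -
  interpret H: delta_lens H by fact
  interpret X: category "Src H" by (rule H.Src_category)
  have D: "u \<in> Arr (Src H) \<Longrightarrow> Dom (Src H) u \<in> Obj (Src H)" for u
    using X.Dom_fun by auto
  have imS: "x \<in> Obj (Src H) \<Longrightarrow> ObjMap H x \<in> S" for x
    using im by auto
  \<comment> \<open>Every arrow of \<open>Tgt H\<close> starting at \<open>ObjMap H x\<close> has
    its domain in \<open>S\<close> and so survives in the smaller target. The same lifting problems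
    are posed, and the lifts, being arrows of the source, can be kept.\<close>
  have L: "liftable (H\<lparr>Tgt := restrict_cat (Tgt H) S\<rparr>) = liftable H"
    by (auto simp: fun_eq_iff liftable_def restrict_cat_def imS)
  have I: "x \<in> Obj (Src H) \<Longrightarrow>
      Ident (restrict_cat (Tgt H) S) (ObjMap H x) = Ident (Tgt H) (ObjMap H x)" for x
    by (simp add: restrict_cat_def imS)
  have C: "composable (restrict_cat (Tgt H) S) v u \<Longrightarrow>
      composable (Tgt H) v u \<and> Comp (restrict_cat (Tgt H) S) v u = Comp (Tgt H) v u" for v u
    using composable_restrict_cat[OF S] by (simp add: restrict_cat_def)
  have m: "ArrMap H u \<in> Arr (Tgt H) \<and> Dom (Tgt H) (ArrMap H u) = ObjMap H (Dom (Src H) u) \<and>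
      Cod (Tgt H) (ArrMap H u) = ObjMap H (Cod (Src H) u)" if "u \<in> Arr (Src H)" for u
    using H.functor_part that by (auto simp: is_functor_def)
  have "is_functor (Src H) (restrict_cat (Tgt H) S) (ObjMap H) (ArrMap H)"
    unfolding is_functor_def
  proof (intro conjI ballI allI impI)
    show "ObjMap H \<in> Obj (Src H) \<rightarrow>\<^sub>E Obj (restrict_cat (Tgt H) S)"
      "ArrMap H \<in> Arr (Src H) \<rightarrow>\<^sub>E Arr (restrict_cat (Tgt H) S)"
      using H.functor_part imS D m by (auto simp: is_functor_def PiE_iff)
    fix v u assume c: "composable (Src H) v u"
    then have "composable (Tgt H) (ArrMap H v) (ArrMap H u)" "Dom (Tgt H) (ArrMap H u) \<in> S"
      using m imS D by (auto simp: composable_def)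
    then show "ArrMap H (Comp (Src H) v u) =
        Comp (restrict_cat (Tgt H) S) (ArrMap H v) (ArrMap H u)"
      using H.functor_part c by (simp add: is_functor_def)
  qed (use H.functor_part in \<open>auto simp: is_functor_def m imS D\<close>)
  then show ?thesis
    by (intro delta_lens.intro)
      (auto simp: L I H.Src_category category_restrict_cat[OF H.Tgt_category S] H.Lift_undefined
        H.Lift_closed H.Dom_Lift H.ArrMap_Lift H.Lift_Ident H.Lift_Comp dest!: C)
qed

text \<open>Existence half of the universal property: the inclusion acts as the identity on
  everything in the image of \<open>H\<close> and on the arrows to be lifted, so composing with it
  only restores the target.\<close>

lemma comp_inclusion_Tgt_update:
  assumes H: "delta_lens H" and S: "cosieve (Tgt H) S" and im: "ObjMap H ` Obj (Src H) \<subseteq> S"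
  shows "comp_lens (inclusion_lens (Tgt H) S) (H\<lparr>Tgt := restrict_cat (Tgt H) S\<rparr>) = H"
proof (rule lens_eqI)
  interpret H: delta_lens H by fact
  interpret X: category "Src H" by (rule H.Src_category)
  let ?K = "H\<lparr>Tgt := restrict_cat (Tgt H) S\<rparr>"
  have imS: "x \<in> Obj (Src H) \<Longrightarrow> ObjMap H x \<in> S" for x
    using im by auto
  show "delta_lens (comp_lens (inclusion_lens (Tgt H) S) ?K)"
    using inclusion_lens_delta_lens[OF H.Tgt_category S] Tgt_update_delta_lens[OF assms]
    by (rule comp_lens_delta_lens) (simp add: inclusion_lens_def)
  show "ArrMap (comp_lens (inclusion_lens (Tgt H) S) ?K) u = ArrMap H u"
    if "u \<in> Arr (Src (comp_lens (inclusion_lens (Tgt H) S) ?K))" for u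
  proof -
    have u: "u \<in> Arr (Src H)" using that by (simp add: comp_lens_def)
    then have "Dom (Src H) u \<in> Obj (Src H)" using X.Dom_fun by auto
    then have "ArrMap H u \<in> Arr (Tgt H)" "Dom (Tgt H) (ArrMap H u) \<in> S"
      using u imS H.functor_part by (auto simp: is_functor_def)
    then show ?thesis using u by (simp add: comp_lens_def compose_def inclusion_lens_def)
  qed
qed (use H im in \<open>auto simp: comp_lens_def compose_def inclusion_lens_def liftable_def\<close>)

text \<open>Uniqueness half: inclusions are monic. Source, object map, arrow map and lifts of
  \<open>J\<close> can all be read off the composite; the one field it forgets is the target, which
  is fixed by assumption.\<close>

lemma comp_inclusion_cancel:
  assumes J: "delta_lens J" "Tgt J = restrict_cat A S" and K: "delta_lens K" "Tgt K = restrict_cat A S"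
    and eq: "comp_lens (inclusion_lens A S) J = comp_lens (inclusion_lens A S) K"
  shows "J = K"
proof -
  have O: "ObjMap (comp_lens (inclusion_lens A S) H) x = ObjMap H x"
    if "delta_lens H" "Tgt H = restrict_cat A S" "x \<in> Obj (Src H)" for H x
    using delta_lens.functor_part[OF that(1)] that(2,3)
    by (auto simp: is_functor_def comp_lens_def compose_def inclusion_lens_def restrict_cat_def)
  have M: "ArrMap (comp_lens (inclusion_lens A S) H) u = ArrMap H u"
    if "delta_lens H" "Tgt H = restrict_cat A S" "u \<in> Arr (Src H)" for H u
  proof -
    have "ArrMap H u \<in> Arr (restrict_cat A S)"
      using delta_lens.functor_part[OF that(1)] that(2,3) by (auto simp: is_functor_def)
    then show ?thesis
      using that(3) by (simp add: comp_lens_def compose_def inclusion_lens_def restrict_cat_def)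
  qed
  have L: "Lift (comp_lens (inclusion_lens A S) H) x u = Lift H x u"
    if "delta_lens H" "Tgt H = restrict_cat A S" "liftable H x u" for H x u
    using that(2,3) O[OF that(1,2)]
    by (auto simp: liftable_def comp_lens_def inclusion_lens_def restrict_cat_def)
  have src: "Src J = Src K"
    using arg_cong[OF eq, of Src] by (simp add: comp_lens_def)
  have o: "ObjMap J x = ObjMap K x" if "x \<in> Obj (Src J)" for x
    using that O[OF J] O[OF K] eq src by metis
  show ?thesis
  proof (rule lens_eqI)
    show "Lift J x u = Lift K x u" if "liftable J x u" for x u
    proof -
      have "liftable K x u"
        using that o src J K by (auto simp: liftable_def)
      then show ?thesis using that L[OF J] L[OF K] eq by metis
    qed
    show "ArrMap J u = ArrMap K u" if "u \<in> Arr (Src J)" for u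
      using that M[OF J] M[OF K] eq src by metis
  qed (use J K src o in auto)
qed

section \<open>The largest cosieve inside a set of objects\<close>

definition largest_cosieve :: "('o, 'm) cat \<Rightarrow> 'o set \<Rightarrow> 'o set" where
  "largest_cosieve A P = {a \<in> Obj A. \<forall>u \<in> Arr A. Dom A u = a \<longrightarrow> Cod A u \<in> P}"

lemma largest_cosieveD:
  "a \<in> largest_cosieve A P \<Longrightarrow> u \<in> Arr A \<Longrightarrow> Dom A u = a \<Longrightarrow> Cod A u \<in> P"
  by (simp add: largest_cosieve_def)

text \<open>An arrow out of \<open>Cod A u\<close>, precomposed with \<open>u\<close>, becomes an
  arrow out of \<open>Dom A u\<close> with the same codomain.\<close>

lemma cosieve_largest_cosieve:
  assumes "category A"
  shows "cosieve A (largest_cosieve A P)"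
  unfolding cosieve_def
proof (intro conjI ballI impI)
  interpret category A by fact
  show "largest_cosieve A P \<subseteq> Obj A"
    by (simp add: largest_cosieve_def)
  fix u assume u: "u \<in> Arr A" and D: "Dom A u \<in> largest_cosieve A P"
  have "Cod A v \<in> P" if "v \<in> Arr A" "Dom A v = Cod A u" for v
  proof -
    have c: "composable A v u" using u that by (simp add: composable_def)
    show ?thesis
      using largest_cosieveD[OF D Comp_closed[OF c] Dom_Comp[OF c]] by (simp add: Cod_Comp[OF c])
  qed
  moreover have "Cod A u \<in> Obj A"
    using Cod_fun u by auto
  ultimately show "Cod A u \<in> largest_cosieve A P"
    by (simp add: largest_cosieve_def)
qed

text \<open>The identity of \<open>a\<close> is among the arrows tested at \<open>a\<close>, and its
  codomain is \<open>a\<close>.\<close>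

lemma largest_cosieve_subset:
  assumes "category A"
  shows "largest_cosieve A P \<subseteq> P"
proof
  interpret category A by fact
  fix a assume a: "a \<in> largest_cosieve A P"
  then have "a \<in> Obj A" by (simp add: largest_cosieve_def)
  then have "Ident A a \<in> Arr A" "Dom A (Ident A a) = a" "Cod A (Ident A a) = a"
    using Ident_fun by (auto simp: Dom_Ident Cod_Ident)
  then show "a \<in> P" using largest_cosieveD[OF a] by metis
qed

lemma cosieve_subset_largest_cosieve:
  assumes "cosieve A S" "S \<subseteq> P"
  shows "S \<subseteq> largest_cosieve A P"
  using assms by (auto simp: cosieve_def largest_cosieve_def)

section \<open>Images of lenses and agreement of a parallel pair\<close>

lemma cosieve_lens_image:
  assumes "delta_lens H"
  shows "cosieve (Tgt H) (ObjMap H ` Obj (Src H))"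
proof -
  interpret H: delta_lens H by fact
  interpret X: category "Src H" by (rule H.Src_category)
  have "Cod (Tgt H) u \<in> ObjMap H ` Obj (Src H)"
    if "x \<in> Obj (Src H)" "u \<in> Arr (Tgt H)" "Dom (Tgt H) u = ObjMap H x" for x u
  proof -
    have l: "liftable H x u" using that by (simp add: liftable_def)
    have "Cod (Tgt H) u = ObjMap H (Cod (Src H) (Lift H x u))"
      using H.functor_part H.Lift_closed[OF l] H.ArrMap_Lift[OF l] by (auto simp: is_functor_def)
    then show ?thesis using X.Cod_fun H.Lift_closed[OF l] by auto
  qed
  then show ?thesis
    using H.functor_part by (auto simp: cosieve_def is_functor_def)
qed

text \<open>All data attached to one object are compared: its image, its lifts, and the images of
  the arrows leaving it, which are the arrows at \<open>a\<close> in a restricted category. This set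
  need not be a cosieve, since \<open>F\<close> and \<open>G\<close> may differ on arrows further
  along.\<close>

definition agreement :: "('o, 'm) lens \<Rightarrow> ('o, 'm) lens \<Rightarrow> 'o set" where
  "agreement F G = {a. ObjMap F a = ObjMap G a \<and> Lift F a = Lift G a \<and>
     (\<forall>u \<in> Arr (Src F). Dom (Src F) u = a \<longrightarrow> ArrMap F u = ArrMap G u)}"

lemma lens_image_subset_agreement:
  assumes F: "delta_lens F" and G: "delta_lens G" and H: "delta_lens H"
    and S: "Src G = Src F" and T: "Tgt G = Tgt F" and TH: "Tgt H = Src F"
    and eq: "comp_lens F H = comp_lens G H"
  shows "ObjMap H ` Obj (Src H) \<subseteq> agreement F G"
proof clarify
  interpret F: delta_lens F by fact
  interpret G: delta_lens G by fact
  interpret H: delta_lens H by fact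
  fix x assume x: "x \<in> Obj (Src H)"
  let ?a = "ObjMap H x"
  have aO: "?a \<in> Obj (Src F)" using H.functor_part x TH by (auto simp: is_functor_def)
  have o: "ObjMap F ?a = ObjMap G ?a"
    using arg_cong[OF eq, of "\<lambda>K. ObjMap K x"] x by (simp add: comp_lens_def compose_def)
  have m: "ArrMap F u = ArrMap G u" if "u \<in> Arr (Src F)" "Dom (Src F) u = ?a" for u
  proof -
    have l: "liftable H x u" using that x TH by (simp add: liftable_def)
    have "ArrMap F (ArrMap H (Lift H x u)) = ArrMap G (ArrMap H (Lift H x u))"
      using arg_cong[OF eq, of "\<lambda>K. ArrMap K (Lift H x u)"] H.Lift_closed[OF l]
      by (simp add: comp_lens_def compose_def)
    then show ?thesis by (simp add: H.ArrMap_Lift[OF l])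
  qed
  have "Lift F ?a v = Lift G ?a v" for v
  proof (cases "liftable F ?a v")
    case True
    then have True': "liftable G ?a v" using o S T by (simp add: liftable_def)
    have "Lift H x (Lift F ?a v) = Lift H x (Lift G ?a v)"
      using arg_cong[OF eq, of "\<lambda>K. Lift K x v"] x True True'
      by (simp add: comp_lens_def liftable_def)
    moreover have "liftable H x (Lift F ?a v)" "liftable H x (Lift G ?a v)"
      using x TH S F.Lift_closed[OF True] F.Dom_Lift[OF True] G.Lift_closed[OF True']
        G.Dom_Lift[OF True'] by (simp_all add: liftable_def)
    \<comment> \<open>\<open>ArrMap H\<close> is a left inverse of \<open>Lift H x\<close> on
      liftable arrows, so \<open>Lift H x\<close> can be cancelled.\<close>
    ultimately show ?thesis using H.ArrMap_Lift by metis
  next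
    \<comment> \<open>The lifts must agree as total functions; where no lift exists, both are
      \<open>undefined\<close>.\<close>
    case False
    then have "\<not> liftable G ?a v" using o S T by (simp add: liftable_def)
    then show ?thesis using False F.Lift_undefined G.Lift_undefined by simp
  qed
  then show "?a \<in> agreement F G" using o m by (auto simp: agreement_def)
qed

lemma comp_inclusion_agreement:
  assumes F: "delta_lens F" and G: "delta_lens G"
    and S: "Src G = Src F" and T: "Tgt G = Tgt F"
    and C: "cosieve (Src F) S" and sub: "S \<subseteq> agreement F G"
  shows "comp_lens F (inclusion_lens (Src F) S) = comp_lens G (inclusion_lens (Src F) S)"
proof -
  have J: "delta_lens (inclusion_lens (Src F) S)"
    by (rule inclusion_lens_delta_lens[OF delta_lens.Src_category[OF F] C])
  have c [simp]: "Src (comp_lens K (inclusion_lens (Src F) S)) = restrict_cat (Src F) S"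
    "Tgt (comp_lens K (inclusion_lens (Src F) S)) = Tgt K"
    "a \<in> S \<Longrightarrow> ObjMap (comp_lens K (inclusion_lens (Src F) S)) a = ObjMap K a"
    "u \<in> Arr (Src F) \<Longrightarrow> Dom (Src F) u \<in> S \<Longrightarrow>
      ArrMap (comp_lens K (inclusion_lens (Src F) S)) u = ArrMap K u"
    for K :: "('a, 'b) lens" and a u
    by (simp_all add: comp_lens_def compose_def)
  \<comment> \<open>The lift along the inclusion is left unevaluated: equality of the inner lifts
    \<open>Lift F a v\<close> and \<open>Lift G a v\<close> is enough.\<close>
  have L: "Lift (comp_lens K (inclusion_lens (Src F) S)) a v =
      Lift (inclusion_lens (Src F) S) a (Lift K a v)"
    if "a \<in> S" "v \<in> Arr (Tgt K)" "Dom (Tgt K) v = ObjMap K a" for K :: "('a, 'b) lens" and a v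
    using that by (simp add: comp_lens_def)
  have agree: "ObjMap F a = ObjMap G a" "Lift F a = Lift G a"
    "\<And>u. u \<in> Arr (Src F) \<Longrightarrow> Dom (Src F) u = a \<Longrightarrow> ArrMap F u = ArrMap G u" if "a \<in> S" for a
    using sub that by (auto simp: agreement_def)
  show ?thesis
  proof (rule lens_eqI)
    show "delta_lens (comp_lens F (inclusion_lens (Src F) S))"
      "delta_lens (comp_lens G (inclusion_lens (Src F) S))"
      using F G J by (simp_all add: comp_lens_delta_lens S)
    fix a v assume "liftable (comp_lens F (inclusion_lens (Src F) S)) a v"
    then have "a \<in> S" "v \<in> Arr (Tgt F)" "Dom (Tgt F) v = ObjMap F a"
      by (auto simp: liftable_def)
    then show "Lift (comp_lens F (inclusion_lens (Src F) S)) a v =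
        Lift (comp_lens G (inclusion_lens (Src F) S)) a v"
      using agree by (simp add: L T)
  qed (use agree T in auto)
qed

section \<open>The equaliser of a parallel pair\<close>

theorem proposition4p7:
  "has_equalisers (Lens :: (('o, 'm) cat, ('o, 'm) lens) cat)"
  unfolding has_equalisers_def
proof (intro ballI impI)
  fix F G :: "('o, 'm) lens"
  assume "F \<in> Arr Lens" "G \<in> Arr Lens" "Dom Lens F = Dom Lens G \<and> Cod Lens F = Cod Lens G"
  then have F: "delta_lens F" and G: "delta_lens G" and S: "Src G = Src F" and T: "Tgt G = Tgt F"
    by (auto simp: Lens_def)
  let ?A = "Src F" and ?S = "largest_cosieve (Src F) (agreement F G)"
  let ?E = "inclusion_lens ?A ?S"
  have A: "category ?A" using F by (rule delta_lens.Src_category)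
  have C: "cosieve ?A ?S" using A by (rule cosieve_largest_cosieve)
  have E: "delta_lens ?E" using A C by (rule inclusion_lens_delta_lens)
  have srcE: "Src ?E = restrict_cat ?A ?S" and tgtE: "Tgt ?E = ?A"
    by (simp_all add: inclusion_lens_def)
  have "comp_lens F ?E = comp_lens G ?E"
    using F G S T C largest_cosieve_subset[OF A] by (rule comp_inclusion_agreement)
  moreover have "\<exists>!K. delta_lens K \<and> Src K = Src H \<and> Tgt K = restrict_cat ?A ?S \<and>
      comp_lens ?E K = H"
    if H: "delta_lens H" and TH: "Tgt H = ?A" and eq: "comp_lens F H = comp_lens G H" for H
  proof (rule ex_ex1I)
    \<comment> \<open>The image of \<open>H\<close> is a cosieve contained in
      \<open>agreement F G\<close>, so it lies in the largest one. This makes the corestriction of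
      \<open>H\<close> available as the mediating lens.\<close>
    have im: "ObjMap H ` Obj (Src H) \<subseteq> ?S"
      using cosieve_lens_image[OF H] lens_image_subset_agreement[OF F G H S T TH eq]
      by (simp add: cosieve_subset_largest_cosieve TH)
    show "\<exists>K. delta_lens K \<and> Src K = Src H \<and> Tgt K = restrict_cat ?A ?S \<and> comp_lens ?E K = H"
      using Tgt_update_delta_lens[OF H _ im] comp_inclusion_Tgt_update[OF H _ im] C
      by (intro exI[of _ "H\<lparr>Tgt := restrict_cat ?A ?S\<rparr>"]) (simp add: TH)
  qed (use comp_inclusion_cancel in blast)
  \<comment> \<open>The structure maps of \<open>Lens\<close> are \<open>undefined\<close> off
    lenses; \<open>conj_cong\<close> supplies membership in \<open>Arr Lens\<close> while the later
    conjuncts about \<open>Dom\<close>, \<open>Cod\<close> and \<open>Comp\<close> are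
    simplified.\<close>
  ultimately show "\<exists>e. is_equaliser Lens F G e"
    using F G E S T
    by (intro exI[of _ ?E]) (auto simp: is_equaliser_def Lens_def srcE tgtE cong: conj_cong)
qed

end
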